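(* For every real $c$ with $0<c<1$ there exist $\delta>0$ and constants $B\ge 0$ and $K>0$ such that for arbitrarily large $n$ there exist an $n$-element set $\mathcal{A}$ of positive integers and a graph $H_n$ with vertex set $\mathcal{A}$ having at least $K^{-1}(\log n)^{-B} n^{1+c}$ edges such that $$|\mathcal{A}+_{H_n}\mathcal{A}|+|\mathcal{A}\cdot_{H_n}\mathcal{A}|\le K(\log n)^{B}\,|\mathcal{A}|^{1+c-\delta}.$$
   Context: For a finite set $\mathcal{A}$ of numbers and a graph $G$ whose vertices are the elements of $\mathcal{A}$, the sumset along $G$ is $\mathcal{A}+_{G}\mathcal{A}=\{a+b : \{a,b\}\in E(G)\}$ and the product set along $G$ is $\mathcal{A}\cdot_{G}\mathcal{A}=\{ab : \{a,b\}\in E(G)\}$. *)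

theory Defs
  imports Complex_Main
begin

definition simple_graph :: "'a set \<Rightarrow> 'a set set \<Rightarrow> bool" where
  "simple_graph V E \<longleftrightarrow> (\<forall>e\<in>E. e \<subseteq> V \<and> card e = 2)"

definition sumset_along :: "'a::plus set set \<Rightarrow> 'a set" where
  "sumset_along E = {a + b | a b. {a, b} \<in> E}"

definition prodset_along :: "'a::times set set \<Rightarrow> 'a set" where
  "prodset_along E = {a * b | a b. {a, b} \<in> E}"

end

theory Submission
  imports Defs
begin

text \<open>
  Fix \<open>m\<close> and \<open>Q = m ^ k\<close> with \<open>k\<close> large, and let \<open>D\<close> be a common multiple of
  \<open>1, \<dots>, m\<close>. For \<open>u \<le> m\<close>, \<open>w\<close> in a set of \<open>Q\<close> integers congruent to \<open>1\<close> modulo \<open>m + 1\<close>,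
  and \<open>y \<le> Q\<close>, join \<open>D u w\<close> to \<open>D y / u\<close>. The congruence lets one recover \<open>u\<close> from \<open>u w\<close>, so
  there are \<open>m Q\<^sup>2\<close> edges on at most \<open>2 m Q\<close> vertices. The products \<open>D\<^sup>2 w y\<close> do not depend
  on \<open>u\<close>, so there are at most \<open>Q\<^sup>2\<close> of them, and the sums \<open>(D / u) (u\<^sup>2 w + y)\<close> number
  \<open>O(m\<^sup>4 Q)\<close>. For large \<open>k\<close> the edge count thus exceeds any given power, below the square, of the
  vertex count, while a factor \<open>m\<close> is saved in the sums and products. Isolated vertices then bring
  the edge exponent down to exactly \<open>1 + c\<close>; no logarithmic factor is needed.
\<close>

section \<open>Vertices and edges of the bipartite graph\<close>

definition upper_vertex :: "int \<Rightarrow> int \<Rightarrow> int \<Rightarrow> int \<Rightarrow> int" where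
  "upper_vertex m D u z = D * (u * (1 + (m + 1) * z))"

definition lower_vertex :: "int \<Rightarrow> int \<Rightarrow> int \<Rightarrow> int" where
  "lower_vertex D u y = (D div u) * y"

definition edge :: "int \<Rightarrow> int \<Rightarrow> int \<times> int \<times> int \<Rightarrow> int set" where
  "edge m D = (\<lambda>(u, z, y). {upper_vertex m D u z, lower_vertex D u y})"

text \<open>The range of \<open>z\<close> starts above \<open>Q\<close> so that every upper vertex exceeds every lower one.\<close>

definition edge_params :: "int \<Rightarrow> int \<Rightarrow> (int \<times> int \<times> int) set" where
  "edge_params m Q = {1..m} \<times> {Q + 1..2 * Q} \<times> {1..Q}"

definition vertices :: "int \<Rightarrow> int \<Rightarrow> int \<Rightarrow> int set" where
  "vertices m D Q = (\<lambda>(u, z). upper_vertex m D u z) ` ({1..m} \<times> {Q + 1..2 * Q})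
     \<union> (\<lambda>(u, y). lower_vertex D u y) ` ({1..m} \<times> {1..Q})"

lemma finite_vertices: "finite (vertices m D Q)"
  by (simp add: vertices_def)

lemma card_vertices_le:
  assumes "m \<ge> 0" "Q \<ge> 0"
  shows "card (vertices m D Q) \<le> 2 * nat m * nat Q"
proof -
  have "card ((\<lambda>(u, z). upper_vertex m D u z) ` ({1..m} \<times> {Q + 1..2 * Q}))
      \<le> card ({1..m} \<times> {Q + 1..2 * Q})"
    by (intro card_image_le) auto
  moreover have "card ((\<lambda>(u, y). lower_vertex D u y) ` ({1..m} \<times> {1..Q})) \<le> card ({1..m} \<times> {1..Q})"
    by (intro card_image_le) auto
  ultimately show ?thesis
    unfolding vertices_def
    using card_Un_le[of "(\<lambda>(u, z). upper_vertex m D u z) ` ({1..m} \<times> {Q + 1..2 * Q})"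
        "(\<lambda>(u, y). lower_vertex D u y) ` ({1..m} \<times> {1..Q})"]
    by (simp add: card_cartesian_product)
qed

context
  fixes m D Q :: int
  assumes m: "m \<ge> 1" and D: "D > 0" and D_dvd: "\<And>u. u \<in> {1..m} \<Longrightarrow> u dvd D" and Q: "Q \<ge> 1"
begin

lemma cofactor_pos: "u \<in> {1..m} \<Longrightarrow> D div u > 0"
  using D_dvd[of u] D by (auto elim!: dvdE simp: zero_less_mult_iff)

lemma lower_vertex_pos: "u \<in> {1..m} \<Longrightarrow> y \<in> {1..Q} \<Longrightarrow> lower_vertex D u y > 0"
  using cofactor_pos[of u] by (simp add: lower_vertex_def)

text \<open>Since \<open>D div u' \<le> D\<close>, lower vertices are at most \<open>D * Q\<close>,
  while upper ones exceed \<open>D * z\<close> with \<open>z > Q\<close>. This separation tells the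
  two ends of an edge apart and makes them distinct.\<close>

lemma lower_less_upper:
  assumes "u \<in> {1..m}" "z \<in> {Q + 1..2 * Q}" "u' \<in> {1..m}" "y \<in> {1..Q}"
  shows "lower_vertex D u' y < upper_vertex m D u z"
proof -
  have "D div u' \<le> D"
    using D_dvd[OF assms(3)] D assms(3) by (intro zdvd_imp_le) (auto simp: div_dvd_iff_mult)
  hence "lower_vertex D u' y \<le> D * Q"
    unfolding lower_vertex_def using assms D by (intro mult_mono) auto
  also have "Q < u * (1 + (m + 1) * z)"
  proof -
    have "0 \<le> m * z" using assms m Q by (intro mult_nonneg_nonneg) auto
    moreover have "Q < z" using assms by simp
    ultimately have "Q < 1 * (1 + (m + 1) * z)" by (simp add: algebra_simps)
    also have "\<dots> \<le> u * (1 + (m + 1) * z)" using assms m Q by (intro mult_right_mono) auto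
    finally show ?thesis .
  qed
  hence "D * Q < upper_vertex m D u z" using D by (simp add: upper_vertex_def)
  finally show ?thesis .
qed

lemma vertices_pos: "a \<in> vertices m D Q \<Longrightarrow> a > 0"
proof -
  assume "a \<in> vertices m D Q"
  then consider u y where "u \<in> {1..m}" "y \<in> {1..Q}" "a = lower_vertex D u y"
    | u z where "u \<in> {1..m}" "z \<in> {Q + 1..2 * Q}" "a = upper_vertex m D u z"
    unfolding vertices_def by auto
  thus "a > 0"
  proof cases
    case 1
    thus ?thesis using lower_vertex_pos by simp
  next
    case 2
    thus ?thesis using lower_less_upper[of u z u 1] lower_vertex_pos[of u 1] Q by simp
  qed
qed

lemma upper_vertex_inject:
  assumes "u \<in> {1..m}" "u' \<in> {1..m}" "upper_vertex m D u z = upper_vertex m D u' z'"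
  shows "u = u' \<and> z = z'"
proof -
  have eq: "u * (1 + (m + 1) * z) = u' * (1 + (m + 1) * z')"
    using assms(3) D by (simp add: upper_vertex_def)
  \<comment> \<open>Residues modulo \<open>m + 1\<close> distinguish the elements of
    \<open>{1..m}\<close>, so reducing \<open>eq\<close> yields \<open>u = u'\<close>; cancelling
    \<open>u\<close> then yields \<open>z = z'\<close>.\<close>
  have red: "v * (1 + (m + 1) * x) mod (m + 1) = v" if "v \<in> {1..m}" for v x
  proof -
    have "v * (1 + (m + 1) * x) = v + (m + 1) * (v * x)" by (simp add: algebra_simps)
    thus ?thesis using that by (simp only: mod_mult_self2) simp
  qed
  have "u = u'" using red[OF assms(1), of z] red[OF assms(2), of z'] eq by simp
  with eq assms m show ?thesis by simp
qed

lemma inj_on_edge: "inj_on (edge m D) (edge_params m Q)"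
proof (rule inj_onI, clarsimp)
  fix u z y u' z' y'
  assume p: "(u, z, y) \<in> edge_params m Q" "(u', z', y') \<in> edge_params m Q"
    and eq: "edge m D (u, z, y) = edge m D (u', z', y')"
  \<comment> \<open>This rules out the crosswise way for the two doubletons to coincide.\<close>
  have "lower_vertex D u' y' < upper_vertex m D u z"
    using p lower_less_upper by (auto simp: edge_params_def)
  hence ab: "upper_vertex m D u z = upper_vertex m D u' z'" "lower_vertex D u y = lower_vertex D u' y'"
    using eq by (auto simp: edge_def doubleton_eq_iff)
  have "u = u' \<and> z = z'"
    using upper_vertex_inject[OF _ _ ab(1)] p by (auto simp: edge_params_def)
  moreover from this have "y = y'"
    using ab(2) cofactor_pos[of u] p by (auto simp: edge_params_def lower_vertex_def)
  ultimately show "u = u' \<and> z = z' \<and> y = y'" by simp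
qed

lemma card_edges: "card (edge m D ` edge_params m Q) = nat m * nat Q ^ 2"
  by (simp add: card_image inj_on_edge)
     (simp add: edge_params_def card_cartesian_product power2_eq_square)

lemma simple_graph_edges:
  assumes "vertices m D Q \<subseteq> A"
  shows "simple_graph A (edge m D ` edge_params m Q)"
  unfolding simple_graph_def
proof (intro ballI)
  fix e assume "e \<in> edge m D ` edge_params m Q"
  then obtain u z y where p: "u \<in> {1..m}" "z \<in> {Q + 1..2 * Q}" "y \<in> {1..Q}"
    and e: "e = {upper_vertex m D u z, lower_vertex D u y}"
    by (auto simp: edge_params_def edge_def)
  have "e \<subseteq> vertices m D Q"
    unfolding e vertices_def using p by force
  moreover have "card e = 2"
    unfolding e using lower_less_upper[OF p(1,2) p(1,3)] by simp
  ultimately show "e \<subseteq> A \<and> card e = 2" using assms by auto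
qed

section \<open>Products and sums along the edges\<close>

lemma upper_times_lower:
  assumes "u \<in> {1..m}"
  shows "upper_vertex m D u z * lower_vertex D u y = D * D * ((1 + (m + 1) * z) * y)"
proof -
  have "u * (D div u) = D" using D_dvd[OF assms] by simp
  hence "D * D * ((1 + (m + 1) * z) * y) = D * (u * (D div u)) * ((1 + (m + 1) * z) * y)" by simp
  thus ?thesis by (simp only: upper_vertex_def lower_vertex_def ac_simps)
qed

lemma upper_plus_lower:
  assumes "u \<in> {1..m}"
  shows "upper_vertex m D u z + lower_vertex D u y = (D div u) * (u * u * (1 + (m + 1) * z) + y)"
proof -
  have "u * (D div u) = D" using D_dvd[OF assms] by simp
  hence "upper_vertex m D u z = u * (D div u) * (u * (1 + (m + 1) * z))"
    by (simp add: upper_vertex_def)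
  thus ?thesis by (simp only: lower_vertex_def distrib_left ac_simps)
qed

lemma card_prodset_le: "card (prodset_along (edge m D ` edge_params m Q)) \<le> nat Q ^ 2"
proof -
  let ?f = "\<lambda>(z, y). D * D * ((1 + (m + 1) * z) * y)"
  have "prodset_along (edge m D ` edge_params m Q) \<subseteq> ?f ` ({Q + 1..2 * Q} \<times> {1..Q})"
  proof
    fix x assume "x \<in> prodset_along (edge m D ` edge_params m Q)"
    then obtain u z y where p: "u \<in> {1..m}" "z \<in> {Q + 1..2 * Q}" "y \<in> {1..Q}"
      and x: "x = upper_vertex m D u z * lower_vertex D u y"
      by (auto simp: prodset_along_def edge_params_def edge_def doubleton_eq_iff mult.commute)
    have "x = ?f (z, y)" using upper_times_lower[OF p(1)] x by simp
    thus "x \<in> ?f ` ({Q + 1..2 * Q} \<times> {1..Q})" using p by blast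
  qed
  hence "card (prodset_along (edge m D ` edge_params m Q)) \<le> card ({Q + 1..2 * Q} \<times> {1..Q})"
    by (rule surj_card_le[rotated]) simp
  thus ?thesis by (simp add: card_cartesian_product power2_eq_square)
qed

text \<open>A sum is fixed by \<open>u\<close>, with \<open>m\<close> choices, and the positive
  integer cofactor of \<open>D div u\<close>, with at most \<open>6 * m ^ 3 * Q\<close>
  choices.\<close>

lemma card_sumset_le: "card (sumset_along (edge m D ` edge_params m Q)) \<le> 6 * nat m ^ 4 * nat Q"
proof -
  let ?f = "\<lambda>(u, s). (D div u) * s"
  let ?S = "{1..m} \<times> {1..6 * m ^ 3 * Q}"
  have "sumset_along (edge m D ` edge_params m Q) \<subseteq> ?f ` ?S"
  proof
    fix x assume "x \<in> sumset_along (edge m D ` edge_params m Q)"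
    then obtain u z y where p: "u \<in> {1..m}" "z \<in> {Q + 1..2 * Q}" "y \<in> {1..Q}"
      and x: "x = upper_vertex m D u z + lower_vertex D u y"
      by (auto simp: sumset_along_def edge_params_def edge_def doubleton_eq_iff add.commute)
    let ?s = "u * u * (1 + (m + 1) * z) + y"
    have w: "1 + (m + 1) * z \<le> 5 * m * Q"
    proof -
      have "(m + 1) * z \<le> (2 * m) * (2 * Q)" using p m Q by (intro mult_mono) auto
      moreover have "1 * 1 \<le> m * Q" using m Q by (intro mult_mono) auto
      ultimately show ?thesis by (simp add: algebra_simps)
    qed
    have "(m + 1) * z \<ge> 0" using p m Q by (intro mult_nonneg_nonneg) auto
    hence w0: "0 \<le> 1 + (m + 1) * z" by simp
    have "u * u \<le> m * m" using p by (intro mult_mono) auto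
    hence "u * u * (1 + (m + 1) * z) \<le> m * m * (5 * m * Q)" using p w w0 by (intro mult_mono) auto
    moreover have "1 * Q \<le> m ^ 3 * Q" using m Q by (intro mult_right_mono) auto
    \<comment> \<open>The 6 splits as 5 from the bound on \<open>1 + (m + 1) * z\<close> and 1 for
      \<open>y\<close>.\<close>
    moreover have "6 * m ^ 3 * Q = m * m * (5 * m * Q) + m ^ 3 * Q" by (simp add: power3_eq_cube)
    moreover have "y \<le> Q" using p by simp
    ultimately have "?s \<le> 6 * m ^ 3 * Q" by linarith
    moreover have "?s \<ge> 1" using p w0 by (simp add: add_nonneg_pos add_increasing)
    ultimately have "(u, ?s) \<in> ?S" using p by simp
    moreover have "x = ?f (u, ?s)" using upper_plus_lower[OF p(1)] x by simp
    ultimately show "x \<in> ?f ` ?S" by blast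
  qed
  hence "card (sumset_along (edge m D ` edge_params m Q)) \<le> card ?S"
    by (rule surj_card_le[rotated]) simp
  also have "\<dots> = 6 * nat m ^ 4 * nat Q"
    using m Q by (simp add: card_cartesian_product nat_mult_distrib nat_power_eq power4_eq_xxxx power3_eq_cube)
  finally show ?thesis .
qed

end

section \<open>Padding with isolated vertices\<close>

lemma finite_int_set_extend_pos:
  fixes V :: "int set"
  assumes "finite V" "\<And>a. a \<in> V \<Longrightarrow> a > 0" "card V \<le> n"
  obtains A where "V \<subseteq> A" "finite A" "card A = n" "\<forall>a\<in>A. a > 0"
proof -
  have "infinite ({0<..} - V)" using assms(1) by (simp add: Diff_infinite_finite infinite_Ioi)
  then obtain X where X: "finite X" "card X = n - card V" "X \<subseteq> {0<..} - V"
    by (metis infinite_arbitrarily_large)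
  show thesis
  proof (rule that[of "V \<union> X"])
    have "V \<inter> X = {}" using X by auto
    then show "card (V \<union> X) = n" using X assms by (simp add: card_Un_disjoint)
  qed (use X assms in auto)
qed

lemma sum_product_graph_exists:
  fixes m k n :: nat
  assumes "m \<ge> 1" "k \<ge> 4" "n \<ge> 2 * m ^ (k + 1)"
  obtains A :: "int set" and E where "finite A" "card A = n" "\<forall>a\<in>A. a > 0" "simple_graph A E"
    "card E = m ^ (2 * k + 1)" "card (sumset_along E) + card (prodset_along E) \<le> 7 * m ^ (2 * k)"
proof -
  \<comment> \<open>The factorial of \<open>m\<close>, a common multiple of
    \<open>1, ..., m\<close>.\<close>
  define D where "D = (\<Prod>u\<in>{1..int m}. u)"
  define Q where "Q = int m ^ k"
  have D: "D > 0" unfolding D_def by (intro prod_pos) auto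
  have dvd: "u dvd D" if "u \<in> {1..int m}" for u unfolding D_def using that by (intro dvd_prodI) auto
  have m: "int m \<ge> 1" and Q: "Q \<ge> 1" using assms(1) by (auto simp: Q_def)
  have natQ: "nat Q = m ^ k" by (simp add: Q_def nat_power_eq)
  note hyps = m D dvd Q
  let ?E = "edge (int m) D ` edge_params (int m) Q"
  have "card (vertices (int m) D Q) \<le> n"
    using card_vertices_le[of "int m" Q D] Q assms(3) by (simp add: natQ)
  then obtain A where A: "vertices (int m) D Q \<subseteq> A" "finite A" "card A = n" "\<forall>a\<in>A. a > 0"
    using finite_int_set_extend_pos[OF finite_vertices vertices_pos[OF hyps]] by metis
  have "card ?E = m ^ (2 * k + 1)"
    using card_edges[OF hyps] by (simp add: natQ power_mult[symmetric] mult.commute)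
  moreover have "card (prodset_along ?E) \<le> m ^ (2 * k)"
    using card_prodset_le[OF hyps] by (simp add: natQ power_mult[symmetric] mult.commute)
  moreover have "card (sumset_along ?E) \<le> 6 * m ^ (2 * k)"
  proof -
    have "card (sumset_along ?E) \<le> 6 * m ^ 4 * m ^ k"
      using card_sumset_le[OF hyps] by (simp add: natQ)
    \<comment> \<open>Here \<open>k \<ge> 4\<close> lets \<open>m ^ 4\<close> be absorbed into a
      second factor \<open>Q\<close>, so sums cost only a constant times the bound for
      products.\<close>
    also have "\<dots> \<le> 6 * m ^ k * m ^ k"
      using assms by (intro mult_mono power_increasing) auto
    finally show ?thesis by (simp add: mult_2 power_add)
  qed
  ultimately show thesis
    using A simple_graph_edges[OF hyps A(1)] by (intro that[of A ?E]) auto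
qed

section \<open>Choice of exponents and parameters\<close>

theorem theorem2p2:
  fixes c :: real
  assumes "0 < c" and "c < 1"
  shows "\<exists>\<delta> B K :: real. \<delta> > 0 \<and> B \<ge> 0 \<and> K > 0 \<and>
    (\<forall>N::nat. \<exists>n\<ge>N. \<exists>(A :: int set) (E :: int set set).
       finite A \<and> card A = n \<and> (\<forall>a\<in>A. a > 0) \<and> simple_graph A E \<and>
       real (card E) \<ge> inverse K * ln (real n) powr (- B) * real n powr (1 + c) \<and>
       real (card (sumset_along E)) + real (card (prodset_along E))
         \<le> K * ln (real n) powr B * real (card A) powr (1 + c - \<delta>))"
proof -
  \<comment> \<open>The 4 is for the sumset bound. The other bound gives
    \<open>k * (1 - c) \<ge> 3 > 1 + 2 * c\<close>, which is what
    \<open>\<theta> \<ge> k + 2\<close> requires, so that the vertices of the graph fit into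
    \<open>n\<close>.\<close>
  define k where "k = max 4 (nat \<lceil>3 / (1 - c)\<rceil>)"
  \<comment> \<open>The number of vertices will be about \<open>m powr \<theta>\<close>, chosen so that the \<open>m ^ (2 * k + 1)\<close> edges
     are this number to the power \<open>1 + c\<close>.\<close>
  define \<theta> where "\<theta> = real (2 * k + 1) / (1 + c)"
  have k4: "k \<ge> 4" by (simp add: k_def)
  have "real k \<ge> 3 / (1 - c)" unfolding k_def by linarith
  hence "3 \<le> real k * (1 - c)" using assms by (simp add: field_simps)
  hence \<theta>_ge: "\<theta> \<ge> real (k + 2)"
    unfolding \<theta>_def using assms by (simp add: field_simps)
  have \<theta>_pos: "\<theta> > 0" using \<theta>_ge by linarith
  have \<theta>_c: "\<theta> * (1 + c) = real (2 * k + 1)" using assms by (simp add: \<theta>_def)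
  \<comment> \<open>Saving one factor \<open>m\<close> lowers the exponent of
    \<open>m powr \<theta>\<close> by \<open>1 / \<theta>\<close>, which is therefore taken as
    \<open>\<delta>\<close>.\<close>
  have \<theta>_\<delta>: "\<theta> * (1 + c - 1 / \<theta>) = real (2 * k)"
    using \<theta>_c \<theta>_pos by (simp add: right_diff_distrib)
  have \<delta>_le: "1 + c - 1 / \<theta> \<ge> 0"
    using \<theta>_\<delta> \<theta>_pos by (smt (verit) of_nat_0_le_iff mult_pos_neg)
  have "\<exists>n\<ge>N. \<exists>(A :: int set) (E :: int set set).
       finite A \<and> card A = n \<and> (\<forall>a\<in>A. a > 0) \<and> simple_graph A E \<and>
       real (card E) \<ge> inverse 7 * ln (real n) powr (- 0) * real n powr (1 + c) \<and>
       real (card (sumset_along E)) + real (card (prodset_along E))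
         \<le> 7 * ln (real n) powr 0 * real (card A) powr (1 + c - 1 / \<theta>)" for N :: nat
  proof -
    \<comment> \<open>\<open>N\<close> makes \<open>n\<close> arbitrarily large; 2 pays for the
      factor 2 in the vertex count and keeps \<open>ln n\<close> nonzero, since
      \<open>0 powr 0 = 0\<close>.\<close>
    define m where "m = max 2 N"
    have m: "m \<ge> 2" "m \<ge> N" by (auto simp: m_def)
    define n where "n = nat \<lceil>real m powr \<theta>\<rceil>"
    have n_ge: "real n \<ge> real m powr \<theta>" unfolding n_def by linarith
    have big: "real m powr \<theta> \<ge> real (m ^ (k + 2))"
    proof -
      have "real (m ^ (k + 2)) = real m powr real (k + 2)" using m by (subst powr_realpow) auto
      also have "\<dots> \<le> real m powr \<theta>" using \<theta>_ge m by (intro powr_mono) auto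
      finally show ?thesis .
    qed
    hence "real n \<ge> real (m ^ (k + 2))" using n_ge by linarith
    hence n_ge': "n \<ge> m ^ (k + 2)" by linarith
    have "2 * m ^ (k + 1) \<le> m ^ (k + 2)" using m by simp
    hence n_vert: "n \<ge> 2 * m ^ (k + 1)" using n_ge' by linarith
    have "m \<le> m ^ (k + 2)" using m by (intro self_le_power) auto
    hence n_m: "n \<ge> m" using n_ge' by linarith
    have "real m powr \<theta> \<ge> 1" using m \<theta>_pos by (intro ge_one_powr_ge_zero) auto
    hence n_le: "real n \<le> 2 * real m powr \<theta>" unfolding n_def by linarith
    have ln0: "ln (real n) powr 0 = 1" using n_m m by simp
    have "m \<ge> 1" using m by simp
    then obtain A :: "int set" and E where AE: "finite A" "card A = n" "\<forall>a\<in>A. a > 0" "simple_graph A E"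
      "card E = m ^ (2 * k + 1)" "card (sumset_along E) + card (prodset_along E) \<le> 7 * m ^ (2 * k)"
      by (rule sum_product_graph_exists[OF _ k4 n_vert])
    \<comment> \<open>Rounding up at most doubles \<open>m powr \<theta>\<close>, which costs at
      most \<open>2 powr 2 = 4\<close> here. The constant 7 needed for sums and products covers
      this.\<close>
    have "real n powr (1 + c) \<le> (2 * real m powr \<theta>) powr (1 + c)"
      using n_le assms by (intro powr_mono2) auto
    also have "\<dots> = 2 powr (1 + c) * real m powr (2 * k + 1)"
      by (simp only: powr_mult powr_powr \<theta>_c)
    also have "\<dots> \<le> 2 powr 2 * real m powr (2 * k + 1)"
      using assms by (intro mult_right_mono powr_mono) auto
    also have "\<dots> = 4 * real m ^ (2 * k + 1)"
      using m by (simp only: powr_realpow) simp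
    also have "\<dots> \<le> 7 * real m ^ (2 * k + 1)" by (intro mult_right_mono) auto
    finally have "real n powr (1 + c) \<le> 7 * real (card E)" by (simp add: AE)
    moreover have "real m ^ (2 * k) \<le> real n powr (1 + c - 1 / \<theta>)"
    proof -
      have "real m ^ (2 * k) = real m powr real (2 * k)" using m by (subst powr_realpow) auto
      also have "\<dots> = (real m powr \<theta>) powr (1 + c - 1 / \<theta>)"
        by (simp only: powr_powr \<theta>_\<delta>)
      also have "\<dots> \<le> real n powr (1 + c - 1 / \<theta>)"
        using n_ge \<delta>_le by (intro powr_mono2) auto
      finally show ?thesis .
    qed
    moreover have "real (card (sumset_along E)) + real (card (prodset_along E)) \<le> 7 * real m ^ (2 * k)"
      using of_nat_mono[OF AE(6), where 'a = real] by simp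
    ultimately have "real (card E) \<ge> inverse 7 * ln (real n) powr (- 0) * real n powr (1 + c)"
      "real (card (sumset_along E)) + real (card (prodset_along E))
         \<le> 7 * ln (real n) powr 0 * real (card A) powr (1 + c - 1 / \<theta>)"
      unfolding minus_zero ln0 AE(2) by auto
    moreover have "n \<ge> N" using n_m m by linarith
    ultimately show ?thesis
      using AE(1-4) by (intro exI[of _ n] conjI exI[of _ A] exI[of _ E])
  qed
  moreover have "1 / \<theta> > 0" "(0 :: real) \<ge> 0" "(7 :: real) > 0" using \<theta>_pos by auto
  ultimately show ?thesis
    by (intro exI[of _ "1 / \<theta>"] exI[of _ "0 :: real"] exI[of _ "7 :: real"] conjI allI)
qed

end
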